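(* Let $k\ge 1$ and $n=p_1\cdots p_k$ with $p_1<\cdots<p_k$ odd primes. Then $g(\Phi_n)\ge \alpha^+(n)$ and $g(\Psi_n)\ge\alpha^-(n)$, where \[ \alpha^{\pm}(n)=\max_{\substack{1\le r<k\\ \rho(k-r)=\mp 1}}\bigl(p_r-\varphi(p_1\cdots p_{r-1})\bigr). \] Here $\alpha^+$ uses the indices $r$ with $\rho(k-r)=-1$ and $\alpha^-$ those with $\rho(k-r)=+1$.
   Context: $\Phi_n(x)=\prod_{1\le j\le n,\ \gcd(j,n)=1}(x-e^{2\pi i j/n})$ is the $n$-th cyclotomic polynomial and $\Psi_n(x)=\prod_{1\le j\le n,\ \gcd(j,n)\ne1}(x-e^{2\pi i j/n})$ is the $n$-th inverse cyclotomic polynomial. For a polynomial $f=c_1x^{\nu_1}+\cdots+c_tx^{\nu_t}$ with all $c_i\ne0$ and $0\le\nu_1<\cdots<\nu_t$, the maximum gap is $g(f)=\max_{1\le i<t}(\nu_{i+1}-\nu_i)$ if $t\ne1$, and $g(f)=0$ if $t=1$. For square-free $d$, $\varphi(d)=\deg\Phi_d$ (Euler's totient). For an integer $i$, $\rho(i)=(-1)^i$. The empty product $p_1\cdots p_0$ equals $1$. *)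

theory Defs
  imports
    "HOL-Analysis.Analysis"
    "HOL-Computational_Algebra.Polynomial"
    "HOL-Number_Theory.Totient"
begin

definition cyclotomic_poly :: "nat \<Rightarrow> complex poly" where
  "cyclotomic_poly n =
     (\<Prod>j\<in>{j. 1 \<le> j \<and> j \<le> n \<and> gcd j n = 1}.
        [:- exp (2 * of_real pi * \<i> * of_nat j / of_nat n), 1:])"

definition inverse_cyclotomic_poly :: "nat \<Rightarrow> complex poly" where
  "inverse_cyclotomic_poly n =
     (\<Prod>j\<in>{j. 1 \<le> j \<and> j \<le> n \<and> gcd j n \<noteq> 1}.
        [:- exp (2 * of_real pi * \<i> * of_nat j / of_nat n), 1:])"

definition poly_exponents :: "'a::zero poly \<Rightarrow> nat list" where
  "poly_exponents f = sorted_list_of_set {i. coeff f i \<noteq> 0}"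

(* The zero polynomial, which has no terms, is given gap 0 as well. The list is
   increasing, so the natural-number subtraction does not truncate. *)
definition max_gap :: "'a::zero poly \<Rightarrow> nat" where
  "max_gap f =
     (let \<nu> = poly_exponents f in
      if length \<nu> \<le> 1 then 0
      else Max {\<nu> ! (i + 1) - \<nu> ! i | i. i + 1 < length \<nu>})"

(* The primes are p 1, ..., p k. The value is an integer because the differences
   may be negative. If no index r is admissible (for instance k = 1), the
   maximum over the empty set is taken to be 0. *)
definition alpha :: "int \<Rightarrow> nat \<Rightarrow> (nat \<Rightarrow> nat) \<Rightarrow> int" where
  "alpha s k p =
     (let A = {int (p r) - int (totient (\<Prod>i=1..<r. p i)) | r.
                 1 \<le> r \<and> r < k \<and> (-1) ^ (k - r) = s}
      in if A = {} then 0 else Max A)"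

definition alpha_plus :: "nat \<Rightarrow> (nat \<Rightarrow> nat) \<Rightarrow> int" where
  "alpha_plus k p = alpha (-1) k p"

definition alpha_minus :: "nat \<Rightarrow> (nat \<Rightarrow> nat) \<Rightarrow> int" where
  "alpha_minus k p = alpha 1 k p"

end

theory Submission
  imports Defs
begin

text \<open>
  For a prime \<open>q\<close> not dividing \<open>m\<close> we have \<open>\<Phi>\<^bsub>mq\<^esub>(x) \<Phi>\<^sub>m(x) = \<Phi>\<^sub>m(x\<^sup>q)\<close>, and the right-hand side is a
  nonzero constant modulo \<open>x\<^sup>N\<close> as soon as \<open>N \<le> q\<close>. Adjoining to \<open>m = p\<^sub>1 \<dots> p\<^bsub>r-1\<^esub>\<close> the primes
  \<open>p\<^sub>r, \<dots>, p\<^sub>k\<close> one at a time, with \<open>N = p\<^sub>r\<close>, therefore alternates, up to nonzero constants, between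
  \<open>\<Phi>\<^sub>m\<close> and its inverse modulo \<open>x\<^sup>N\<close>. Hence \<open>\<Phi>\<^sub>n\<close> is a multiple of \<open>\<Phi>\<^sub>m\<close> modulo \<open>x\<^sup>N\<close> if \<open>k - r\<close> is
  odd; if \<open>k - r\<close> is even, \<open>\<Psi>\<^sub>n\<close> is one, because \<open>\<Psi>\<^sub>n \<Phi>\<^sub>n = x\<^sup>n - 1\<close>. In both cases no exponent lies
  strictly between \<open>\<phi>(m)\<close> and \<open>p\<^sub>r\<close>, and the degree is at least \<open>p\<^sub>r\<close>.
\<close>

section \<open>Gaps of polynomials\<close>

text \<open>The exponent \<open>a\<close> is not the last one, since \<open>degree f\<close> is a
  larger exponent. Its successor in the sorted list avoids the zero range and so is at least
  \<open>b\<close>.\<close>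

lemma max_gap_ge:
  fixes f :: "'a::zero poly"
  assumes "coeff f a \<noteq> 0" and "a < b" and "b \<le> degree f"
    and zero: "\<And>i. a < i \<Longrightarrow> i < b \<Longrightarrow> coeff f i = 0"
  shows "b - a \<le> max_gap f"
proof -
  define S where "S = {i. coeff f i \<noteq> 0}"
  define \<nu> where "\<nu> = sorted_list_of_set S"
  have "S \<subseteq> {..degree f}" by (auto simp: S_def le_degree)
  then have fin: "finite S" by (rule finite_subset) simp
  have set: "set \<nu> = S" and sorted: "sorted_wrt (<) \<nu>"
    using fin by (simp_all add: \<nu>_def)
  have "a \<in> S" "degree f \<in> S"
    using assms by (auto simp: S_def)
  then obtain i j where i: "i < length \<nu>" "\<nu> ! i = a" and j: "j < length \<nu>" "\<nu> ! j = degree f"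
    unfolding set[symmetric] in_set_conv_nth by blast
  have "i < j"
  proof (rule ccontr)
    assume "\<not> i < j"
    then have "\<nu> ! j \<le> \<nu> ! i"
      using sorted i(1) by (cases "i = j") (auto simp: sorted_wrt_iff_nth_less intro: less_imp_le)
    then show False using i j assms by simp
  qed
  then have len: "i + 1 < length \<nu>" using j by simp
  then have "\<nu> ! (i + 1) \<in> S" "a < \<nu> ! (i + 1)"
    using set sorted i by (auto simp: sorted_wrt_iff_nth_less)
  then have "b \<le> \<nu> ! (i + 1)"
    using zero[of "\<nu> ! (i + 1)"] by (auto simp: S_def not_less[symmetric])
  then have "b - a \<le> \<nu> ! (i + 1) - \<nu> ! i" using i by simp
  also have "\<dots> \<le> Max {\<nu> ! (i + 1) - \<nu> ! i | i. i + 1 < length \<nu>}"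
  proof (rule Max_ge)
    have "{\<nu> ! (i + 1) - \<nu> ! i | i. i + 1 < length \<nu>}
        \<subseteq> (\<lambda>i. \<nu> ! (i + 1) - \<nu> ! i) ` {..<length \<nu>}" by auto
    then show "finite {\<nu> ! (i + 1) - \<nu> ! i | i. i + 1 < length \<nu>}"
      by (rule finite_subset) simp
  qed (use len in auto)
  also have "\<dots> = max_gap f"
    using len by (auto simp: max_gap_def poly_exponents_def \<nu>_def S_def Let_def)
  finally show ?thesis .
qed

lemma cong_monom_iff:
  fixes f g :: "complex poly"
  shows "[f = g] (mod monom 1 N) \<longleftrightarrow> (\<forall>i<N. coeff f i = coeff g i)"
  by (simp add: cong_iff_dvd_diff monom_1_dvd_iff')

text \<open>Below \<open>N\<close> the exponents of \<open>f\<close> are those of \<open>g\<close>,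
  so if \<open>degree g < N\<close>, it is an exponent of \<open>f\<close> and none follows it
  before \<open>N\<close>. The bound on \<open>degree f\<close> supplies a later one.\<close>

lemma max_gap_ge_of_cong:
  fixes f g :: "complex poly"
  assumes "[f = [:c:] * g] (mod monom 1 N)" and "c \<noteq> 0" and "g \<noteq> 0" and "N \<le> degree f"
  shows "N - degree g \<le> max_gap f"
proof (cases "degree g < N")
  case True
  have coeff: "coeff f i = c * coeff g i" if "i < N" for i
    using assms(1) that by (simp add: cong_monom_iff)
  show ?thesis
    by (rule max_gap_ge) (use True coeff assms in \<open>auto simp: coeff_eq_0\<close>)
qed simp

text \<open>Writing f = a + x g gives f(x^q) = a + x^q g(x^q), and x^N divides x^q.\<close>

lemma pcompose_monom_cong:
  fixes f :: "complex poly"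
  assumes "N \<le> q"
  shows "[f \<circ>\<^sub>p monom 1 q = [:poly f 0:]] (mod monom 1 N)"
proof (cases f)
  case (pCons a g)
  have "monom 1 N dvd (monom 1 q :: complex poly)"
    using assms by (simp add: monom_1_dvd_iff')
  then show ?thesis
    by (simp add: pCons pcompose_pCons cong_iff_dvd_diff)
qed

section \<open>Cyclotomic polynomials\<close>

text \<open>For \<open>n > 0\<close> these are the numbers of multiplicative order exactly
  \<open>n\<close>. This form reduces questions about powers to divisibility of exponents.\<close>

definition primitive_roots :: "nat \<Rightarrow> complex set" where
  "primitive_roots n = {z. \<forall>k. z ^ k = 1 \<longleftrightarrow> n dvd k}"

text \<open>Both sides are monic of degree \<open>n\<close> and vanish at the \<open>n\<close>
  roots, which are distinct because \<open>c\<close> is nonzero.\<close>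

lemma prod_nth_roots:
  fixes c :: complex
  assumes "c \<noteq> 0" and "n > 0"
  shows "(\<Prod>z\<in>{z. z ^ n = c}. [:- z, 1:]) = monom 1 n - [:c:]"
proof -
  have card: "card {z. z ^ n = c} = n" using assms by (rule card_nth_roots)
  have fin: "finite {z. z ^ n = c}" using assms by (intro finite_nth_roots) auto
  have deg: "degree (\<Prod>z\<in>{z. z ^ n = c}. [:- z, 1:]) = n"
    by (subst degree_prod_eq_sum_degree) (auto simp: card)
  have lead: "coeff (\<Prod>z\<in>{z. z ^ n = c}. [:- z, 1:]) n = 1"
    using lead_coeff_prod[of "\<lambda>z. [:- z, 1:]" "{z. z ^ n = c}"] by (simp add: deg)
  show ?thesis
  proof (rule poly_eqI_degree_lead_coeff[where A = "{z. z ^ n = c}" and n = n])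
    show "coeff (\<Prod>z\<in>{z. z ^ n = c}. [:- z, 1:]) n = coeff (monom 1 n - [:c:]) n"
      using assms(2) by (simp add: lead coeff_eq_0)
    show "degree (monom 1 n - [:c:]) \<le> n"
      by (intro degree_diff_le) (auto simp: degree_monom_eq)
    fix z assume "z \<in> {z. z ^ n = c}"
    then show "poly (\<Prod>z\<in>{z. z ^ n = c}. [:- z, 1:]) z = poly (monom 1 n - [:c:]) z"
      using fin by (auto simp: poly_prod poly_monom prod_zero_iff)
  qed (use card deg in auto)
qed

section \<open>Roots of unity as exponentials\<close>

definition unity_root :: "nat \<Rightarrow> nat \<Rightarrow> complex" where
  "unity_root n j = exp (2 * of_real pi * \<i> * of_nat j / of_nat n)"

lemma unity_root_pow: "unity_root n j ^ k = unity_root n (j * k)"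
  by (simp add: unity_root_def exp_of_nat_mult[symmetric] field_simps)

lemma unity_root_eq_1_iff: "n > 0 \<Longrightarrow> unity_root n j = 1 \<longleftrightarrow> n dvd j"
  unfolding unity_root_def by (rule complex_root_unity_eq_1) simp

lemma inj_on_unity_root: "inj_on (unity_root n) {1..n}"
proof (rule inj_onI)
  fix i j assume ij: "i \<in> {1..n}" "j \<in> {1..n}" "unity_root n i = unity_root n j"
  then have "i mod n = j mod n"
    unfolding unity_root_def by (subst (asm) complex_root_unity_eq) auto
  \<comment> \<open>In \<open>{1..n}\<close> only \<open>n\<close> has residue 0, so equal residues
    still force equal indices.\<close>
  then show "i = j" using ij by (cases "i = n"; cases "j = n") auto
qed

lemma unity_root_image:
  assumes "n > 0"
  shows "unity_root n ` {1..n} = {z. z ^ n = 1}"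
proof (rule card_subset_eq)
  show "finite {z::complex. z ^ n = 1}" using assms by (intro finite_nth_roots) auto
  show "unity_root n ` {1..n} \<subseteq> {z. z ^ n = 1}"
    using assms by (auto simp: unity_root_pow unity_root_eq_1_iff)
  show "card (unity_root n ` {1..n}) = card {z::complex. z ^ n = 1}"
    using assms card_image[OF inj_on_unity_root[of n]] by (simp add: card_nth_roots)
qed

lemma unity_root_primitive_iff:
  assumes "n > 0"
  shows "unity_root n j \<in> primitive_roots n \<longleftrightarrow> coprime j n"
proof
  assume prim: "unity_root n j \<in> primitive_roots n"
  \<comment> \<open>The exponent \<open>n div d\<close> already sends the root to 1, so primitivity
    leaves only \<open>d = 1\<close>.\<close>
  define d where "d = gcd j n"
  have d: "d dvd j" "d dvd n" by (auto simp: d_def)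
  have "n dvd j * (n div d)"
    using d by (auto elim!: dvdE)
  then have "n dvd n div d"
    using prim assms by (auto simp: primitive_roots_def unity_root_pow unity_root_eq_1_iff)
  then have "n \<le> n div d"
    using assms d by (intro dvd_imp_le) (auto simp: div_greater_zero_iff dvd_imp_le)
  then have "\<not> 1 < d" using assms by (meson div_less_dividend leD)
  moreover have "d > 0" using assms by (simp add: d_def)
  ultimately have "d = 1" by simp
  then show "coprime j n" by (simp add: d_def coprime_iff_gcd_eq_1)
next
  assume "coprime j n"
  then have "coprime n j" by (simp add: coprime_commute)
  then show "unity_root n j \<in> primitive_roots n"
    using assms by (simp add: primitive_roots_def unity_root_pow unity_root_eq_1_iff
        coprime_dvd_mult_right_iff)
qed

lemma primitive_roots_eq_image:
  assumes "n > 0"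
  shows "primitive_roots n = unity_root n ` {j. 1 \<le> j \<and> j \<le> n \<and> gcd j n = 1}"
proof -
  have "primitive_roots n \<subseteq> unity_root n ` {1..n}"
    unfolding unity_root_image[OF assms] by (simp add: primitive_roots_def subset_iff)
  then show ?thesis
    using unity_root_primitive_iff[OF assms] by (auto simp: coprime_iff_gcd_eq_1)
qed

lemma finite_primitive_roots: "n > 0 \<Longrightarrow> finite (primitive_roots n)"
  by (simp add: primitive_roots_eq_image)

lemma cyclotomic_poly_conv_primitive_roots:
  assumes "n > 0"
  shows "cyclotomic_poly n = (\<Prod>z\<in>primitive_roots n. [:- z, 1:])"
  unfolding cyclotomic_poly_def primitive_roots_eq_image[OF assms] unity_root_def[symmetric]
  by (subst prod.reindex) (auto intro: inj_on_subset[OF inj_on_unity_root])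

lemma degree_cyclotomic_poly: "degree (cyclotomic_poly n) = totient n"
proof -
  have "{j. 1 \<le> j \<and> j \<le> n \<and> gcd j n = 1} = totatives n"
    by (auto simp: totatives_def coprime_iff_gcd_eq_1)
  then show ?thesis
    unfolding cyclotomic_poly_def by (subst degree_prod_eq_sum_degree) (auto simp: totient_def)
qed

text \<open>All roots are exponentials, hence nonzero. This keeps the constants in the later
  congruences invertible.\<close>

lemma poly_cyclotomic_0_nonzero: "poly (cyclotomic_poly n) 0 \<noteq> 0"
  by (simp add: cyclotomic_poly_def poly_prod)

lemma cyclotomic_poly_nonzero: "cyclotomic_poly n \<noteq> 0"
  using poly_cyclotomic_0_nonzero[of n] by auto

lemma inverse_cyclotomic_mult_cyclotomic:
  assumes "n > 0"
  shows "inverse_cyclotomic_poly n * cyclotomic_poly n = monom 1 n - 1"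
proof -
  have "inverse_cyclotomic_poly n * cyclotomic_poly n = (\<Prod>j\<in>{1..n}. [:- unity_root n j, 1:])"
    unfolding inverse_cyclotomic_poly_def cyclotomic_poly_def unity_root_def[symmetric]
    by (subst prod.union_disjoint[symmetric]) (auto intro!: prod.cong)
  also have "\<dots> = (\<Prod>z\<in>{z. z ^ n = 1}. [:- z, 1:])"
    unfolding unity_root_image[OF assms, symmetric] prod.reindex[OF inj_on_unity_root] by simp
  finally show ?thesis
    using assms by (simp add: prod_nth_roots one_pCons)
qed

text \<open>The \<open>M\<close> multiples of \<open>q\<close> up to \<open>n\<close> share the
  factor \<open>q > 1\<close> with \<open>n\<close>, so each contributes a linear factor.\<close>

lemma degree_inverse_cyclotomic_poly_ge:
  assumes "n = q * M" and "q > 1" and "M > 0"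
  shows "M \<le> degree (inverse_cyclotomic_poly n)"
proof -
  let ?A = "{j. 1 \<le> j \<and> j \<le> n \<and> gcd j n \<noteq> 1}"
  have "(\<lambda>i. q * i) ` {1..M} \<subseteq> ?A"
    using assms by (auto simp: gcd_mult_distrib_nat[symmetric])
  moreover have "card ((\<lambda>i. q * i) ` {1..M}) = M"
    using assms by (subst card_image) (auto simp: inj_on_def)
  moreover have "finite ?A" by simp
  ultimately have "M \<le> card ?A" by (metis card_mono)
  also have "\<dots> = degree (inverse_cyclotomic_poly n)"
    unfolding inverse_cyclotomic_poly_def by (subst degree_prod_eq_sum_degree) auto
  finally show ?thesis .
qed

section \<open>Adjoining a prime\<close>

text \<open>If \<open>w ^ q\<close> has order \<open>m\<close>, the order of \<open>w\<close> is a
  multiple of \<open>m\<close> and divides \<open>m * q\<close>; since \<open>q\<close> is prime, it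
  is one of these two. Conversely, taking \<open>q\<close>-th powers reduces order
  \<open>m * q\<close> to \<open>m\<close>, and preserves order \<open>m\<close> by
  coprimality.\<close>

lemma primitive_roots_prime_preimage:
  assumes q: "prime q" and ndvd: "\<not> q dvd m"
  shows "{w. w ^ q \<in> primitive_roots m} = primitive_roots (m * q) \<union> primitive_roots m"
proof -
  have cop: "coprime m q"
    using prime_imp_coprime[OF q ndvd] by (simp add: coprime_commute)
  have q0: "q > 0" using q by (simp add: prime_gt_0_nat)
  have "w \<in> primitive_roots (m * q) \<union> primitive_roots m" if "w ^ q \<in> primitive_roots m" for w
  proof -
    have w: "w ^ (q * k) = 1 \<longleftrightarrow> m dvd k" for k
      using that by (auto simp: primitive_roots_def power_mult)
    have mdvd: "m dvd k" if "w ^ k = 1" for k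
      using w[of k] that by (simp add: mult.commute[of q] power_mult)
    show ?thesis
    proof (cases "w ^ m = 1")
      case True
      then have "w \<in> primitive_roots m"
        using mdvd by (auto simp: primitive_roots_def power_mult elim!: dvdE)
      then show ?thesis by simp
    next
      case False
      have "m * q dvd k" if wk: "w ^ k = 1" for k
      proof -
        obtain l where l: "k = m * l" using mdvd[OF wk] by (elim dvdE)
        have "q dvd l"
        proof (rule ccontr)
          assume "\<not> q dvd l"
          then have "coprime l q" using prime_imp_coprime[OF q] by (simp add: coprime_commute)
          moreover have "l \<noteq> 0" using \<open>\<not> q dvd l\<close> by (metis dvd_0_right)
          \<comment> \<open>Bezout gives \<open>k * a = q * (m * b) + m\<close>. As
            \<open>w ^ k\<close> and \<open>w ^ (q * (m * b))\<close> are 1, so is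
            \<open>w ^ m\<close>, against the case assumption.\<close>
          ultimately obtain a b where ab: "l * a = q * b + 1"
            using bezout_nat[of l q] by auto
          have "1 = w ^ (k * a)" using wk by (simp add: power_mult)
          also have "k * a = m * (l * a)" by (simp add: l)
          also have "\<dots> = q * (m * b) + m" unfolding ab by (simp add: algebra_simps)
          also have "w ^ \<dots> = w ^ m" using w[of "m * b"] by (simp add: power_add)
          finally show False using False by simp
        qed
        then show ?thesis by (simp add: l)
      qed
      moreover have "w ^ k = 1" if "m * q dvd k" for k
        using w[of m] that by (auto simp: power_mult mult.commute[of m q] elim!: dvdE)
      ultimately show ?thesis by (auto simp: primitive_roots_def)
    qed
  qed
  moreover have "w ^ q \<in> primitive_roots m" if "w \<in> primitive_roots (m * q)" for w
    using that q0 by (auto simp: primitive_roots_def power_mult[symmetric] mult.commute[of m q])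
  moreover have "w ^ q \<in> primitive_roots m" if "w \<in> primitive_roots m" for w
    using that cop by (auto simp: primitive_roots_def power_mult[symmetric] coprime_dvd_mult_right_iff)
  ultimately show ?thesis by blast
qed

text \<open>The right-hand side is the product of x^q - z over the primitive \<open>m\<close>-th
  roots z. Each factor splits over the \<open>q\<close>-th roots of z, and together these are the
  primitive roots of orders \<open>m * q\<close> and \<open>m\<close>.\<close>

lemma cyclotomic_poly_mult_prime:
  assumes q: "prime q" and ndvd: "\<not> q dvd m"
  shows "cyclotomic_poly (m * q) * cyclotomic_poly m = cyclotomic_poly m \<circ>\<^sub>p monom 1 q"
proof -
  have q0: "q > 0" using q by (simp add: prime_gt_0_nat)
  have m0: "m > 0" using ndvd by (cases m) auto
  have "\<not> m * q dvd m" using prime_gt_1_nat[OF q] m0 by auto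
  moreover have "m * q dvd m" if "z \<in> primitive_roots (m * q)" "z \<in> primitive_roots m" for z
  proof -
    have "z ^ m = 1" using that(2) by (simp add: primitive_roots_def)
    then show ?thesis using that(1) by (simp add: primitive_roots_def)
  qed
  ultimately have disj: "primitive_roots (m * q) \<inter> primitive_roots m = {}" by blast
  \<comment> \<open>A nonzero z is what makes x^q - z a product over distinct roots.\<close>
  have nz: "z \<noteq> 0" if "z \<in> primitive_roots m" for z
  proof
    assume "z = 0"
    then have "z ^ m \<noteq> 1" using m0 by (simp add: power_0_left)
    then show False using that by (auto simp: primitive_roots_def)
  qed
  have "cyclotomic_poly (m * q) * cyclotomic_poly m
      = (\<Prod>w\<in>primitive_roots (m * q) \<union> primitive_roots m. [:- w, 1:])"
    using m0 q0 disj
    by (simp add: cyclotomic_poly_conv_primitive_roots prod.union_disjoint finite_primitive_roots)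
  also have "primitive_roots (m * q) \<union> primitive_roots m
      = (\<Union>z\<in>primitive_roots m. {w. w ^ q = z})"
    using primitive_roots_prime_preimage[OF assms] by auto
  also have "(\<Prod>w\<in>\<dots>. [:- w, 1:]) = (\<Prod>z\<in>primitive_roots m. \<Prod>w\<in>{w. w ^ q = z}. [:- w, 1:])"
    by (rule prod.UNION_disjoint) (use m0 q0 in \<open>auto simp: finite_primitive_roots\<close>)
  also have "\<dots> = (\<Prod>z\<in>primitive_roots m. monom 1 q - [:z:])"
    using nz q0 by (intro prod.cong) (simp_all add: prod_nth_roots)
  also have "\<dots> = (\<Prod>z\<in>primitive_roots m. [:- z, 1:] \<circ>\<^sub>p monom 1 q)"
    by (intro prod.cong) (simp_all add: pcompose_pCons diff_conv_add_uminus add.commute)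
  also have "\<dots> = cyclotomic_poly m \<circ>\<^sub>p monom 1 q"
    using m0 by (simp add: cyclotomic_poly_conv_primitive_roots pcompose_prod)
  finally show ?thesis .
qed

lemma cong_const_mult_cancel:
  fixes f g h :: "complex poly"
  assumes "[f * [:c:] = g] (mod h)" and "c \<noteq> 0"
  shows "[f = [:1 / c:] * g] (mod h)"
  using cong_mult[OF cong_refl[of "[:1 / c:]"] assms(1)] assms(2) by simp

text \<open>The odd case is stated as a product, so that no inverse modulo x^N has to be named. The
  primes can be adjoined in any order and therefore form a set.\<close>

lemma cyclotomic_poly_mult_primes_cong:
  assumes "finite Q" and "\<And>q. q \<in> Q \<Longrightarrow> prime q \<and> \<not> q dvd m \<and> N \<le> q"
  shows "\<exists>c. c \<noteq> 0 \<and>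
    (if even (card Q)
     then [cyclotomic_poly (m * \<Prod>Q) = [:c:] * cyclotomic_poly m] (mod monom 1 N)
     else [cyclotomic_poly (m * \<Prod>Q) * cyclotomic_poly m = [:c:]] (mod monom 1 N))"
  using assms
proof (induction Q rule: finite_induct)
  case empty
  show ?case by (intro exI[of _ 1]) simp
next
  case (insert q Q)
  let ?\<Phi> = "cyclotomic_poly m" and ?A = "cyclotomic_poly (m * \<Prod>Q)"
    and ?B = "cyclotomic_poly (m * \<Prod>(insert q Q))"
  have q: "prime q" "\<not> q dvd m" "N \<le> q" using insert.prems by auto
  have "\<not> q dvd \<Prod>Q"
    using insert.hyps insert.prems primes_dvd_imp_eq[OF q(1)] by (auto simp: prime_dvd_prod_iff[OF _ q(1)])
  then have "\<not> q dvd m * \<Prod>Q" using q by (simp add: prime_dvd_mult_iff)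
  then have "?B * ?A = ?A \<circ>\<^sub>p monom 1 q"
    using cyclotomic_poly_mult_prime[OF q(1), of "m * \<Prod>Q"] insert.hyps by (simp add: mult_ac)
  \<comment> \<open>The constant \<open>d\<close> is the value of \<open>?A\<close> at 0.\<close>
  then obtain d where d: "d \<noteq> 0" "[?B * ?A = [:d:]] (mod monom 1 N)"
    using pcompose_monom_cong[OF q(3), of ?A] poly_cyclotomic_0_nonzero[of "m * \<Prod>Q"] by auto
  obtain c where c: "c \<noteq> 0" and
    IH: "if even (card Q) then [?A = [:c:] * ?\<Phi>] (mod monom 1 N)
         else [?A * ?\<Phi> = [:c:]] (mod monom 1 N)"
    using insert.IH insert.prems by blast
  show ?case
  proof (cases "even (card Q)")
    case True
    then have "[?A = [:c:] * ?\<Phi>] (mod monom 1 N)" using IH by simp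
    from cong_trans[OF cong_sym[OF cong_mult[OF cong_refl[of ?B] this]] d(2)]
    have "[(?B * ?\<Phi>) * [:c:] = [:d:]] (mod monom 1 N)" by (simp add: mult_ac)
    from cong_const_mult_cancel[OF this c]
    have "[?B * ?\<Phi> = [:d / c:]] (mod monom 1 N)" by simp
    then show ?thesis
      using True insert.hyps c d(1) by (intro exI[of _ "d / c"]) simp
  next
    case False
    then have "[?A * ?\<Phi> = [:c:]] (mod monom 1 N)" using IH by simp
    \<comment> \<open>The product \<open>?B * ?A * ?\<Phi>\<close> is evaluated in two ways: through
      \<open>?A * ?\<Phi>\<close> and through \<open>?B * ?A\<close>.\<close>
    from cong_trans[OF cong_sym[OF cong_mult[OF cong_refl[of ?B] this]]]
      cong_mult[OF d(2) cong_refl[of ?\<Phi>]]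
    have "[?B * [:c:] = [:d:] * ?\<Phi>] (mod monom 1 N)" by (simp add: mult.assoc)
    from cong_const_mult_cancel[OF this c]
    have "[?B = [:d / c:] * ?\<Phi>] (mod monom 1 N)" by simp
    then show ?thesis
      using False insert.hyps c d(1) by (intro exI[of _ "d / c"]) simp
  qed
qed

section \<open>Gap bounds from the congruences\<close>

lemma max_gap_cyclotomic_ge:
  assumes "finite Q" and Q: "\<And>q. q \<in> Q \<Longrightarrow> prime q \<and> \<not> q dvd m \<and> N \<le> q"
    and "even (card Q)" and "N \<le> totient (m * \<Prod>Q)"
  shows "N - totient m \<le> max_gap (cyclotomic_poly (m * \<Prod>Q))"
proof -
  obtain c where "c \<noteq> 0"
    "[cyclotomic_poly (m * \<Prod>Q) = [:c:] * cyclotomic_poly m] (mod monom 1 N)"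
    using cyclotomic_poly_mult_primes_cong[OF assms(1) Q] assms(3) by auto
  with max_gap_ge_of_cong[of _ c "cyclotomic_poly m" N] show ?thesis
    using assms(4) by (simp add: degree_cyclotomic_poly cyclotomic_poly_nonzero)
qed

lemma max_gap_inverse_cyclotomic_ge:
  assumes "finite Q" and Q: "\<And>q. q \<in> Q \<Longrightarrow> prime q \<and> \<not> q dvd m \<and> N \<le> q"
    and "odd (card Q)" and deg: "N \<le> degree (inverse_cyclotomic_poly (m * \<Prod>Q))"
    and "N \<le> m * \<Prod>Q" and "m * \<Prod>Q > 0"
  shows "N - totient m \<le> max_gap (inverse_cyclotomic_poly (m * \<Prod>Q))"
proof -
  let ?\<Phi> = "cyclotomic_poly (m * \<Prod>Q)" and ?\<Psi> = "inverse_cyclotomic_poly (m * \<Prod>Q)"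
    and ?\<Phi>m = "cyclotomic_poly m"
  obtain c where c: "c \<noteq> 0" "[?\<Phi> * ?\<Phi>m = [:c:]] (mod monom 1 N)"
    using cyclotomic_poly_mult_primes_cong[OF assms(1) Q] assms(3) by auto
  \<comment> \<open>The product is x^n - 1 with n = \<open>m * \<Prod>Q\<close>, and x^n vanishes
    modulo x^N because \<open>N\<close> is at most n.\<close>
  have "[?\<Psi> * ?\<Phi> = - 1] (mod monom 1 N)"
    using assms(5,6) by (simp add: inverse_cyclotomic_mult_cyclotomic cong_monom_iff)
  from cong_trans[OF cong_sym[OF cong_mult[OF cong_refl[of ?\<Psi>] c(2)]]]
    cong_mult[OF this cong_refl[of ?\<Phi>m]]
  have "[?\<Psi> * [:c:] = - ?\<Phi>m] (mod monom 1 N)" by (simp add: mult.assoc)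
  from cong_const_mult_cancel[OF this c(1)]
  have "[?\<Psi> = [:- 1 / c:] * ?\<Phi>m] (mod monom 1 N)" by simp
  from max_gap_ge_of_cong[OF this] show ?thesis
    using c deg by (simp add: degree_cyclotomic_poly cyclotomic_poly_nonzero)
qed

text \<open>The assumption \<open>0 \<le> b\<close> covers the default value 0 of
  \<open>alpha\<close> when no index is admissible.\<close>

lemma alpha_le:
  assumes "0 \<le> b"
    and "\<And>r. 1 \<le> r \<Longrightarrow> r < k \<Longrightarrow> (-1) ^ (k - r) = s \<Longrightarrow>
      int (p r) - int (totient (\<Prod>i=1..<r. p i)) \<le> b"
  shows "alpha s k p \<le> b"
  unfolding alpha_def Let_def using assms by (auto simp: Max_le_iff)

theorem theorem1:
  fixes k n :: nat and p :: "nat \<Rightarrow> nat"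
  assumes "k \<ge> 1"
    and "\<And>i. i \<in> {1..k} \<Longrightarrow> prime (p i) \<and> odd (p i)"
    and "strict_mono_on {1..k} p"
    and "n = (\<Prod>i=1..k. p i)"
  shows "int (max_gap (cyclotomic_poly n)) \<ge> alpha_plus k p \<and>
         int (max_gap (inverse_cyclotomic_poly n)) \<ge> alpha_minus k p"
proof -
  have prime: "prime (p i)" if "i \<in> {1..k}" for i using assms(2) that by blast
  have less: "p i < p j" if "i \<in> {1..k}" "j \<in> {1..k}" "i < j" for i j
    using assms(3) that by (auto simp: strict_mono_on_def)
  have inj: "inj_on p {1..k}" using assms(3) by (rule strict_mono_on_imp_inj_on)
  have n0: "n > 0" unfolding assms(4) using prime by (auto intro!: prod_pos prime_gt_0_nat)
  \<comment> \<open>Splitting off the largest prime bounds both degrees from below: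
    \<open>totient n\<close> by \<open>p k - 1\<close>, and that of the inverse polynomial by
    \<open>M\<close>.\<close>
  define M where "M = (\<Prod>i=1..<k. p i)"
  have nM: "n = p k * M"
    using assms(1,4) by (simp add: M_def atLeastLessThanSuc_atLeastAtMost[symmetric])
  have pk: "prime (p k)" using prime assms(1) by simp
  have M0: "M > 0" using n0 nM by (cases M) auto
  have "\<not> p k dvd M"
  proof
    assume "p k dvd M"
    then obtain i where i: "i \<in> {1..<k}" "p k dvd p i"
      using pk by (auto simp: M_def prime_dvd_prod_iff)
    then show False using prime[of i] prime[of k] less[of i k] primes_dvd_imp_eq[of "p k" "p i"] by auto
  qed
  then have "totient n = (p k - 1) * totient M"
    unfolding nM using pk by (simp add: totient_mult_coprime prime_imp_coprime totient_prime)
  moreover have "1 \<le> totient M" using M0 by (simp add: Suc_le_eq)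
  ultimately have totient_n: "p k - 1 \<le> totient n"
    using mult_le_mono2[of 1 "totient M" "p k - 1"] by (simp only: mult_1_right)
  \<comment> \<open>Subtraction truncates here, so the left sides are at least the integer
    differences in \<open>alpha\<close>.\<close>
  have bound: "(even (k - r) \<longrightarrow> p r - totient (\<Prod>i=1..<r. p i) \<le> max_gap (inverse_cyclotomic_poly n)) \<and>
      (odd (k - r) \<longrightarrow> p r - totient (\<Prod>i=1..<r. p i) \<le> max_gap (cyclotomic_poly n))"
    if r: "1 \<le> r" "r < k" for r
  proof -
    define m where "m = (\<Prod>i=1..<r. p i)"
    define Q where "Q = p ` {r..k}"
    have injQ: "inj_on p {r..k}" using r by (intro inj_on_subset[OF inj]) auto
    \<comment> \<open>\<open>Q\<close> includes \<open>p r\<close> itself, so the parity of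
      \<open>card Q\<close> is opposite to that of \<open>k - r\<close>.\<close>
    have card: "card Q = Suc (k - r)" using r injQ by (simp add: Q_def card_image)
    have "{1..k} = {1..<r} \<union> {r..k}" using r by auto
    then have mQ: "n = m * \<Prod>Q"
      unfolding assms(4) m_def Q_def
      by (simp add: prod.union_disjoint[symmetric] prod.reindex[OF injQ] ivl_disj_int)
    have Q: "prime q \<and> \<not> q dvd m \<and> p r \<le> q" if qQ: "q \<in> Q" for q
    proof -
      obtain j where j: "j \<in> {r..k}" "q = p j" using qQ by (auto simp: Q_def)
      have "\<not> p j dvd p i" if "i \<in> {1..<r}" for i
        using that j r prime[of i] prime[of j] less[of i j] primes_dvd_imp_eq[of "p j" "p i"] by auto
      then have "\<not> p j dvd m"
        using prime[of j] j r by (auto simp: m_def prime_dvd_prod_iff)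
      moreover have "p r \<le> p j" using less[of r j] j r by (cases "r = j") auto
      ultimately show ?thesis using j r prime by auto
    qed
    have "p r dvd M" using r by (auto simp: M_def)
    then have prM: "p r \<le> M" using M0 by (rule dvd_imp_le)
    \<comment> \<open>Since \<open>r < k\<close>, the prime \<open>p r\<close> is at most
      \<open>p k - 1\<close>.\<close>
    have "p r \<le> totient n" using totient_n less[of r k] r by simp
    moreover have "p r \<le> degree (inverse_cyclotomic_poly n)"
      using prM degree_inverse_cyclotomic_poly_ge[OF nM prime_gt_1_nat[OF pk] M0] by simp
    moreover have "p r \<le> n" using prM nM prime_gt_0_nat[OF pk] by (metis le_trans mult_le_mono1 nat_mult_1 less_eq_Suc_le One_nat_def)
    moreover have "finite Q" by (simp add: Q_def)
    ultimately show ?thesis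
      using max_gap_cyclotomic_ge[of Q m "p r"] max_gap_inverse_cyclotomic_ge[of Q m "p r"] Q card n0
      unfolding mQ[symmetric] m_def[symmetric] by auto
  qed
  have "alpha_plus k p \<le> int (max_gap (cyclotomic_poly n))"
    unfolding alpha_plus_def
  proof (rule alpha_le)
    fix r assume r: "1 \<le> r" "r < k" "(-1) ^ (k - r) = (-1::int)"
    then have "odd (k - r)" by (cases "even (k - r)") simp_all
    with bound[OF r(1,2)]
    show "int (p r) - int (totient (\<Prod>i=1..<r. p i)) \<le> int (max_gap (cyclotomic_poly n))"
      by linarith
  qed simp
  moreover have "alpha_minus k p \<le> int (max_gap (inverse_cyclotomic_poly n))"
    unfolding alpha_minus_def
  proof (rule alpha_le)
    fix r assume r: "1 \<le> r" "r < k" "(-1) ^ (k - r) = (1::int)"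
    then have "even (k - r)" by (cases "even (k - r)") simp_all
    with bound[OF r(1,2)]
    show "int (p r) - int (totient (\<Prod>i=1..<r. p i)) \<le> int (max_gap (inverse_cyclotomic_poly n))"
      by linarith
  qed simp
  ultimately show ?thesis by blast
qed

end
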